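(* Let $R$ be a commutative ring with identity, $M$ a unital $R$-module, $N$ a submodule of $M$, and $S$ a multiplicatively closed subset of $R$. (1) If $N$ is a weakly $S$-primary submodule of $M$, then $S^{-1}N$ is a weakly primary submodule of $S^{-1}M$. Moreover, if in addition $Z(M)\cap S=\emptyset$, then there exists $s\in S$ such that $(N:_M t)\subseteq (N:_M s)$ for all $t\in S$. (2) Suppose $M$ is finitely generated and $Z(M)\cap S=\emptyset$. If $S^{-1}N$ is a weakly primary submodule of $S^{-1}M$ and there exists $s\in S$ such that $(N:_M t)\subseteq(N:_M s)$ for all $t\in S$, then $N$ is a weakly $S$-primary submodule of $M$.
   Context: A multiplicatively closed subset of $R$ is a non-empty subset closed under multiplication. $(N:_R M)=\{r\in R: rM\subseteq N\}$ and $(N:_M t)=\{m\in M: tm\in N\}$. $Z(M)=\{r\in R: rm=0\text{ for some }m\in M\setminus\{0\}\}$. $S^{-1}M$ is the localization, a module over $S^{-1}R$. A proper submodule $P$ of an $A$-module $X$ is weakly primary if for $a\in A$, $x\in X$, $0\neq ax\in P$ implies $a\in\sqrt{(P:_A X)}$ or $x\in P$. A submodule $N$ of $M$ is weakly $S$-primary if $(N:_R M)\cap S=\emptyset$ and there exists a fixed $s\in S$ such that for all $a\in R$ and $m\in M$, $0\neq am\in N$ implies $sa\in\sqrt{(N:_R M)}$ or $sm\in N$.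
   Formalization: The first claim of (1) is proved when S^{-1}N ≠ S^{-1}M, or M is finitely generated, or Z(M)∩S=∅; otherwise S^{-1}N may fail to be proper, e.g. R=Z, M=Q/Z, N=0, S=Z∖{0}, where the claim is false. *)

theory Defs
  imports "HOL-Algebra.Module"
begin

section \<open>Multiplicatively closed subsets, residuals, radicals\<close>

text \<open>Neither \<open>\<one> \<in> S\<close> nor \<open>\<zero> \<notin> S\<close> is required of a multiplicatively closed set.\<close>

definition mult_closed :: "('a, 'x) ring_scheme \<Rightarrow> 'a set \<Rightarrow> bool" where
  "mult_closed R S \<longleftrightarrow>
     S \<subseteq> carrier R \<and> S \<noteq> {} \<and> (\<forall>s\<in>S. \<forall>t\<in>S. s \<otimes>\<^bsub>R\<^esub> t \<in> S)"

definition residual ::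
  "('a, 'x) ring_scheme \<Rightarrow> ('a, 'b, 'y) module_scheme \<Rightarrow> 'b set \<Rightarrow> 'a set" where
  "residual R M N = {r \<in> carrier R. \<forall>m\<in>carrier M. r \<odot>\<^bsub>M\<^esub> m \<in> N}"

definition elt_residual :: "('a, 'b, 'y) module_scheme \<Rightarrow> 'b set \<Rightarrow> 'a \<Rightarrow> 'b set" where
  "elt_residual M N t = {m \<in> carrier M. t \<odot>\<^bsub>M\<^esub> m \<in> N}"

definition zero_divisors_on ::
  "('a, 'x) ring_scheme \<Rightarrow> ('a, 'b, 'y) module_scheme \<Rightarrow> 'a set" where
  "zero_divisors_on R M =
     {r \<in> carrier R. \<exists>m\<in>carrier M - {\<zero>\<^bsub>M\<^esub>}. r \<odot>\<^bsub>M\<^esub> m = \<zero>\<^bsub>M\<^esub>}"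

definition radical :: "('a, 'x) ring_scheme \<Rightarrow> 'a set \<Rightarrow> 'a set" where
  "radical R I = {a \<in> carrier R. \<exists>n::nat. n > 0 \<and> a [^]\<^bsub>R\<^esub> n \<in> I}"

definition finitely_generated ::
  "('a, 'x) ring_scheme \<Rightarrow> ('a, 'b, 'y) module_scheme \<Rightarrow> bool" where
  "finitely_generated R M \<longleftrightarrow>
     (\<exists>G. finite G \<and> G \<subseteq> carrier M \<and> \<Inter>{H. submodule H R M \<and> G \<subseteq> H} = carrier M)"


section \<open>Localization\<close>

text \<open>
  The fraction \<open>m / s\<close> is the class of \<open>(m, s)\<close> under
  \<open>(m, s) \<sim> (n, t) \<longleftrightarrow> (\<exists>u\<in>S. u (t m) = u (s n))\<close>. Fractions of ring elements are the special
  case of the ring viewed as a module over itself. Since \<open>\<one>\<close> need not lie in \<open>S\<close>, the elements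
  \<open>0\<close> and \<open>1\<close> of the localizations are the classes \<open>0 / s\<close> and \<open>s / s\<close>, which
  do not depend on \<open>s \<in> S\<close>.
\<close>

definition regular_module :: "('a, 'x) ring_scheme \<Rightarrow> ('a, 'a) module" where
  "regular_module R = \<lparr>carrier = carrier R, mult = mult R, one = one R, zero = zero R,
     add = add R, smult = mult R\<rparr>"

definition fraction ::
  "('a, 'b, 'y) module_scheme \<Rightarrow> 'a set \<Rightarrow> 'b \<Rightarrow> 'a \<Rightarrow> ('b \<times> 'a) set" where
  "fraction M S m s = {(n, t). n \<in> carrier M \<and> t \<in> S \<and>
     (\<exists>u\<in>S. u \<odot>\<^bsub>M\<^esub> (t \<odot>\<^bsub>M\<^esub> m) = u \<odot>\<^bsub>M\<^esub> (s \<odot>\<^bsub>M\<^esub> n))}"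

abbreviation ring_fraction ::
  "('a, 'x) ring_scheme \<Rightarrow> 'a set \<Rightarrow> 'a \<Rightarrow> 'a \<Rightarrow> ('a \<times> 'a) set" where
  "ring_fraction R \<equiv> fraction (regular_module R)"

definition loc_ring :: "('a, 'x) ring_scheme \<Rightarrow> 'a set \<Rightarrow> ('a \<times> 'a) set ring" where
  "loc_ring R S = \<lparr>
     carrier = {ring_fraction R S a s | a s. a \<in> carrier R \<and> s \<in> S},
     mult = (\<lambda>X Y. \<Union>(a, s)\<in>X. \<Union>(b, t)\<in>Y. ring_fraction R S (a \<otimes>\<^bsub>R\<^esub> b) (s \<otimes>\<^bsub>R\<^esub> t)),
     one = (\<Union>s\<in>S. ring_fraction R S s s),
     zero = (\<Union>s\<in>S. ring_fraction R S \<zero>\<^bsub>R\<^esub> s),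
     add = (\<lambda>X Y. \<Union>(a, s)\<in>X. \<Union>(b, t)\<in>Y.
              ring_fraction R S (t \<otimes>\<^bsub>R\<^esub> a \<oplus>\<^bsub>R\<^esub> s \<otimes>\<^bsub>R\<^esub> b) (s \<otimes>\<^bsub>R\<^esub> t))\<rparr>"

text \<open>The fields \<open>mult\<close> and \<open>one\<close>, inherited from ring records, play no role in a module.\<close>

definition loc_module ::
  "('a, 'x) ring_scheme \<Rightarrow> ('a, 'b, 'y) module_scheme \<Rightarrow> 'a set
    \<Rightarrow> (('a \<times> 'a) set, ('b \<times> 'a) set) module" where
  "loc_module R M S = \<lparr>
     carrier = {fraction M S m s | m s. m \<in> carrier M \<and> s \<in> S},
     mult = undefined,
     one = undefined,
     zero = (\<Union>s\<in>S. fraction M S \<zero>\<^bsub>M\<^esub> s),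
     add = (\<lambda>X Y. \<Union>(m, s)\<in>X. \<Union>(n, t)\<in>Y.
              fraction M S (t \<odot>\<^bsub>M\<^esub> m \<oplus>\<^bsub>M\<^esub> s \<odot>\<^bsub>M\<^esub> n) (s \<otimes>\<^bsub>R\<^esub> t)),
     smult = (\<lambda>X Y. \<Union>(a, s)\<in>X. \<Union>(m, t)\<in>Y. fraction M S (a \<odot>\<^bsub>M\<^esub> m) (s \<otimes>\<^bsub>R\<^esub> t))\<rparr>"

definition loc_submodule ::
  "('a, 'b, 'y) module_scheme \<Rightarrow> 'a set \<Rightarrow> 'b set \<Rightarrow> ('b \<times> 'a) set set" where
  "loc_submodule M S N = {fraction M S n s | n s. n \<in> N \<and> s \<in> S}"


section \<open>Weakly primary and weakly S-primary submodules\<close>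

text \<open>
  Weakly primary submodules are proper by definition. If \<open>N\<close> is weakly \<open>S\<close>-primary,
  then \<open>S\<^sup>-\<^sup>1N\<close> need not be proper in \<open>S\<^sup>-\<^sup>1M\<close>: take \<open>R = \<int>\<close>, \<open>M = \<rat>/\<int>\<close>,
  \<open>N = 0\<close>, \<open>S = \<int> - {0}\<close>, where \<open>(N : M) = 0\<close> and \<open>S\<^sup>-\<^sup>1M = 0\<close>. It is proper when
  \<open>M\<close> is finitely generated or no element of \<open>S\<close> is a zero divisor on \<open>M\<close>.
\<close>

definition weakly_primary ::
  "('a, 'x) ring_scheme \<Rightarrow> ('a, 'b, 'y) module_scheme \<Rightarrow> 'b set \<Rightarrow> bool" where
  "weakly_primary A X P \<longleftrightarrow> submodule P A X \<and> P \<noteq> carrier X \<and>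
     (\<forall>a\<in>carrier A. \<forall>x\<in>carrier X.
        a \<odot>\<^bsub>X\<^esub> x \<noteq> \<zero>\<^bsub>X\<^esub> \<and> a \<odot>\<^bsub>X\<^esub> x \<in> P \<longrightarrow> a \<in> radical A (residual A X P) \<or> x \<in> P)"

definition weakly_S_primary ::
  "('a, 'x) ring_scheme \<Rightarrow> ('a, 'b, 'y) module_scheme \<Rightarrow> 'a set \<Rightarrow> 'b set \<Rightarrow> bool" where
  "weakly_S_primary R M S N \<longleftrightarrow> submodule N R M \<and> residual R M N \<inter> S = {} \<and>
     (\<exists>s\<in>S. \<forall>a\<in>carrier R. \<forall>m\<in>carrier M.
        a \<odot>\<^bsub>M\<^esub> m \<noteq> \<zero>\<^bsub>M\<^esub> \<and> a \<odot>\<^bsub>M\<^esub> m \<in> N \<longrightarrow>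
          s \<otimes>\<^bsub>R\<^esub> a \<in> radical R (residual R M N) \<or> s \<odot>\<^bsub>M\<^esub> m \<in> N)"


section \<open>The localizations form a ring and a module over it\<close>

lemma abelian_group_transfer:
  fixes G (structure)
  assumes "abelian_group G" "carrier H = carrier G" "add H = add G" "zero H = zero G"
  shows "abelian_group H"
proof -
  interpret abelian_group G by fact
  show ?thesis
  proof (rule abelian_groupI; unfold assms(2-4))
    show "\<exists>y\<in>carrier G. y \<oplus> x = \<zero>" if "x \<in> carrier G" for x
      using that by (intro bexI[of _ "\<ominus> x"]) (auto simp: l_neg)
  qed (auto simp: a_ac)
qed

lemma (in cring) regular_module: "module R (regular_module R)"
proof (rule moduleI)
  show "abelian_group (regular_module R)"
    by (rule abelian_group_transfer[OF abelian_group_axioms]) (simp_all add: regular_module_def)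
qed (use is_cring in \<open>simp_all add: regular_module_def l_distr r_distr m_assoc\<close>)

locale module_loc = module +
  fixes S
  assumes S: "mult_closed R S"
begin

lemma S_carrier [simp, intro]: "s \<in> S \<Longrightarrow> s \<in> carrier R"
  and S_closed [simp, intro]: "s \<in> S \<Longrightarrow> t \<in> S \<Longrightarrow> s \<otimes> t \<in> S"
  and S_nonempty: "S \<noteq> {}"
  using S by (auto simp: mult_closed_def)

lemma fraction_altdef:
  assumes "m \<in> carrier M" "s \<in> S"
  shows "(n, t) \<in> fraction M S m s \<longleftrightarrow>
    n \<in> carrier M \<and> t \<in> S \<and> (\<exists>u\<in>S. (u \<otimes> t) \<odot>\<^bsub>M\<^esub> m = (u \<otimes> s) \<odot>\<^bsub>M\<^esub> n)"
  using assms by (auto simp: fraction_def smult_assoc1)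

lemma fraction_refl: "m \<in> carrier M \<Longrightarrow> s \<in> S \<Longrightarrow> (m, s) \<in> fraction M S m s"
  using S_nonempty by (auto simp: fraction_altdef)

lemma fraction_sym:
  assumes "m \<in> carrier M" "s \<in> S" "(n, t) \<in> fraction M S m s"
  shows "(m, s) \<in> fraction M S n t"
proof -
  obtain u where "n \<in> carrier M" "t \<in> S" "u \<in> S" "(u \<otimes> t) \<odot>\<^bsub>M\<^esub> m = (u \<otimes> s) \<odot>\<^bsub>M\<^esub> n"
    using assms by (auto simp: fraction_altdef)
  then show ?thesis using assms(1,2) by (auto simp: fraction_altdef intro!: bexI[of _ u])
qed

lemma fraction_trans:
  assumes m: "m \<in> carrier M" "s \<in> S" and n: "(n, t) \<in> fraction M S m s"
    and k: "(k, r) \<in> fraction M S n t"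
  shows "(k, r) \<in> fraction M S m s"
proof -
  have nt: "n \<in> carrier M" "t \<in> S" using n m by (auto simp: fraction_altdef)
  have kr: "k \<in> carrier M" "r \<in> S" using k nt by (auto simp: fraction_altdef)
  obtain u where u: "u \<in> S" "(u \<otimes> t) \<odot>\<^bsub>M\<^esub> m = (u \<otimes> s) \<odot>\<^bsub>M\<^esub> n"
    using n m by (auto simp: fraction_altdef)
  obtain v where v: "v \<in> S" "(v \<otimes> r) \<odot>\<^bsub>M\<^esub> n = (v \<otimes> t) \<odot>\<^bsub>M\<^esub> k"
    using k nt by (auto simp: fraction_altdef)
  have "((u \<otimes> v \<otimes> t) \<otimes> r) \<odot>\<^bsub>M\<^esub> m = ((v \<otimes> r) \<otimes> (u \<otimes> t)) \<odot>\<^bsub>M\<^esub> m"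
    using m nt kr u(1) v(1) by (simp add: m_ac)
  also have "\<dots> = (v \<otimes> r) \<odot>\<^bsub>M\<^esub> ((u \<otimes> s) \<odot>\<^bsub>M\<^esub> n)"
    using m nt kr u v(1) by (simp add: smult_assoc1[of "v \<otimes> r" "u \<otimes> t"])
  also have "\<dots> = ((u \<otimes> s) \<otimes> (v \<otimes> r)) \<odot>\<^bsub>M\<^esub> n"
    using m nt kr u(1) v(1) by (simp add: smult_assoc1[symmetric] m_ac)
  also have "\<dots> = (u \<otimes> s) \<odot>\<^bsub>M\<^esub> ((v \<otimes> t) \<odot>\<^bsub>M\<^esub> k)"
    using m nt kr u(1) v by (simp add: smult_assoc1[of "u \<otimes> s" "v \<otimes> r"])
  also have "\<dots> = ((u \<otimes> v \<otimes> t) \<otimes> s) \<odot>\<^bsub>M\<^esub> k"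
    using m nt kr u(1) v(1) by (simp add: smult_assoc1[symmetric] m_ac)
  finally show ?thesis
    using m kr nt u(1) v(1) by (auto simp: fraction_altdef intro!: bexI[of _ "u \<otimes> v \<otimes> t"])
qed

lemma fraction_eqI':
  assumes "m \<in> carrier M" "s \<in> S" "(n, t) \<in> fraction M S m s"
  shows "fraction M S m s = fraction M S n t"
proof -
  have nt: "n \<in> carrier M" "t \<in> S" using assms by (auto simp: fraction_altdef)
  show ?thesis
    using fraction_trans[OF assms] fraction_trans[OF nt fraction_sym[OF assms]] by auto
qed

lemma fraction_eq_iff:
  assumes "m \<in> carrier M" "s \<in> S" "n \<in> carrier M" "t \<in> S"
  shows "fraction M S m s = fraction M S n t \<longleftrightarrow>
    (\<exists>u\<in>S. (u \<otimes> t) \<odot>\<^bsub>M\<^esub> m = (u \<otimes> s) \<odot>\<^bsub>M\<^esub> n)"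
proof -
  have "fraction M S m s = fraction M S n t \<longleftrightarrow> (n, t) \<in> fraction M S m s"
    using fraction_eqI'[OF assms(1,2), of n t] fraction_refl[OF assms(3,4)] by metis
  then show ?thesis using assms by (simp add: fraction_altdef)
qed

lemma fraction_eqI:
  assumes "m \<in> carrier M" "s \<in> S" "n \<in> carrier M" "t \<in> S" "t \<odot>\<^bsub>M\<^esub> m = s \<odot>\<^bsub>M\<^esub> n"
  shows "fraction M S m s = fraction M S n t"
proof -
  obtain u where "u \<in> S" using S_nonempty by auto
  then show ?thesis using assms by (auto simp: fraction_eq_iff smult_assoc1 intro!: bexI[of _ u])
qed

lemma UN_fraction_eqI:
  assumes "m \<in> carrier M" "s \<in> S"
    and "\<And>m' s'. m' \<in> carrier M \<Longrightarrow> s' \<in> S \<Longrightarrow> fraction M S m' s' = fraction M S m s \<Longrightarrow> f m' s' = A"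
  shows "(\<Union>(m', s')\<in>fraction M S m s. f m' s') = A"
proof -
  have *: "f m' s' = A" if "(m', s') \<in> fraction M S m s" for m' s'
    using fraction_eqI'[OF assms(1,2) that] that
    by (intro assms(3)) (simp_all add: fraction_def)
  have "(\<Union>(m', s')\<in>fraction M S m s. f m' s') = (\<Union>_\<in>fraction M S m s. A)"
    by (intro SUP_cong) (use * in auto)
  then show ?thesis using fraction_refl[OF assms(1,2)] by (auto simp only: UN_constant split: if_splits)
qed

lemma zero_loc_module: "s \<in> S \<Longrightarrow> \<zero>\<^bsub>loc_module R M S\<^esub> = fraction M S \<zero>\<^bsub>M\<^esub> s"
proof -
  assume s: "s \<in> S"
  have *: "fraction M S \<zero>\<^bsub>M\<^esub> t = fraction M S \<zero>\<^bsub>M\<^esub> s" if "t \<in> S" for t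
    using that s by (intro fraction_eqI) auto
  have "(\<Union>t\<in>S. fraction M S \<zero>\<^bsub>M\<^esub> t) = (\<Union>t\<in>S. fraction M S \<zero>\<^bsub>M\<^esub> s)"
    by (intro SUP_cong refl *)
  then show ?thesis using S_nonempty by (simp add: loc_module_def)
qed

lemma add_loc_module:
  assumes "m \<in> carrier M" "s \<in> S" "n \<in> carrier M" "t \<in> S"
  shows "fraction M S m s \<oplus>\<^bsub>loc_module R M S\<^esub> fraction M S n t =
    fraction M S (t \<odot>\<^bsub>M\<^esub> m \<oplus>\<^bsub>M\<^esub> s \<odot>\<^bsub>M\<^esub> n) (s \<otimes> t)"
proof -
  have *: "fraction M S (t' \<odot>\<^bsub>M\<^esub> m' \<oplus>\<^bsub>M\<^esub> s' \<odot>\<^bsub>M\<^esub> n') (s' \<otimes> t')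
      = fraction M S (t \<odot>\<^bsub>M\<^esub> m \<oplus>\<^bsub>M\<^esub> s \<odot>\<^bsub>M\<^esub> n) (s \<otimes> t)"
    if m': "m' \<in> carrier M" "s' \<in> S" "fraction M S m' s' = fraction M S m s"
      and n': "n' \<in> carrier M" "t' \<in> S" "fraction M S n' t' = fraction M S n t" for m' s' n' t'
  proof -
    obtain u where u: "u \<in> S" "(u \<otimes> s) \<odot>\<^bsub>M\<^esub> m' = (u \<otimes> s') \<odot>\<^bsub>M\<^esub> m"
      using m' assms by (auto simp: fraction_eq_iff)
    obtain v where v: "v \<in> S" "(v \<otimes> t) \<odot>\<^bsub>M\<^esub> n' = (v \<otimes> t') \<odot>\<^bsub>M\<^esub> n"
      using n' assms by (auto simp: fraction_eq_iff)
    note cl = assms m'(1,2) n'(1,2) u(1) v(1)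
    have 1: "(u \<otimes> v \<otimes> s \<otimes> t \<otimes> t') \<odot>\<^bsub>M\<^esub> m' = (u \<otimes> v \<otimes> s' \<otimes> t' \<otimes> t) \<odot>\<^bsub>M\<^esub> m"
    proof -
      have "(u \<otimes> v \<otimes> s \<otimes> t \<otimes> t') \<odot>\<^bsub>M\<^esub> m' = ((v \<otimes> t \<otimes> t') \<otimes> (u \<otimes> s)) \<odot>\<^bsub>M\<^esub> m'"
        using cl by (simp add: m_ac)
      also have "\<dots> = (v \<otimes> t \<otimes> t') \<odot>\<^bsub>M\<^esub> ((u \<otimes> s') \<odot>\<^bsub>M\<^esub> m)"
        using cl u by (simp add: smult_assoc1[of "v \<otimes> t \<otimes> t'"])
      also have "\<dots> = (u \<otimes> v \<otimes> s' \<otimes> t' \<otimes> t) \<odot>\<^bsub>M\<^esub> m"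
        using cl by (simp add: smult_assoc1[symmetric] m_ac)
      finally show ?thesis .
    qed
    have 2: "(u \<otimes> v \<otimes> s \<otimes> t \<otimes> s') \<odot>\<^bsub>M\<^esub> n' = (u \<otimes> v \<otimes> s' \<otimes> t' \<otimes> s) \<odot>\<^bsub>M\<^esub> n"
    proof -
      have "(u \<otimes> v \<otimes> s \<otimes> t \<otimes> s') \<odot>\<^bsub>M\<^esub> n' = ((u \<otimes> s \<otimes> s') \<otimes> (v \<otimes> t)) \<odot>\<^bsub>M\<^esub> n'"
        using cl by (simp add: m_ac)
      also have "\<dots> = (u \<otimes> s \<otimes> s') \<odot>\<^bsub>M\<^esub> ((v \<otimes> t') \<odot>\<^bsub>M\<^esub> n)"
        using cl v by (simp add: smult_assoc1[of "u \<otimes> s \<otimes> s'"])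
      also have "\<dots> = (u \<otimes> v \<otimes> s' \<otimes> t' \<otimes> s) \<odot>\<^bsub>M\<^esub> n"
        using cl by (simp add: smult_assoc1[symmetric] m_ac)
      finally show ?thesis .
    qed
    have "((u \<otimes> v) \<otimes> (s \<otimes> t)) \<odot>\<^bsub>M\<^esub> (t' \<odot>\<^bsub>M\<^esub> m' \<oplus>\<^bsub>M\<^esub> s' \<odot>\<^bsub>M\<^esub> n')
        = (u \<otimes> v \<otimes> s \<otimes> t \<otimes> t') \<odot>\<^bsub>M\<^esub> m' \<oplus>\<^bsub>M\<^esub> (u \<otimes> v \<otimes> s \<otimes> t \<otimes> s') \<odot>\<^bsub>M\<^esub> n'"
      using cl by (simp add: smult_r_distr smult_assoc1[symmetric] m_assoc)
    also have "\<dots> = ((u \<otimes> v) \<otimes> (s' \<otimes> t')) \<odot>\<^bsub>M\<^esub> (t \<odot>\<^bsub>M\<^esub> m \<oplus>\<^bsub>M\<^esub> s \<odot>\<^bsub>M\<^esub> n)"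
      unfolding 1 2 using cl by (simp add: smult_r_distr smult_assoc1[symmetric] m_assoc)
    finally show ?thesis
      using cl by (subst fraction_eq_iff) (auto intro!: bexI[of _ "u \<otimes> v"])
  qed
  show ?thesis
    using assms by (simp add: loc_module_def) (intro UN_fraction_eqI *; assumption)
qed

lemma fraction_in_carrier [simp, intro]:
  "m \<in> carrier M \<Longrightarrow> s \<in> S \<Longrightarrow> fraction M S m s \<in> carrier (loc_module R M S)"
  by (auto simp: loc_module_def)

lemma abelian_group_loc_module: "abelian_group (loc_module R M S)" (is "abelian_group ?L")
proof (rule abelian_groupI)
  have car: "carrier ?L = {fraction M S m s | m s. m \<in> carrier M \<and> s \<in> S}"
    by (simp add: loc_module_def)
  obtain e where e: "e \<in> S" using S_nonempty by auto
  show "x \<oplus>\<^bsub>?L\<^esub> y \<in> carrier ?L" if xy: "x \<in> carrier ?L" "y \<in> carrier ?L" for x y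
  proof -
    obtain m s n t where "m \<in> carrier M" "s \<in> S" "x = fraction M S m s"
      "n \<in> carrier M" "t \<in> S" "y = fraction M S n t" using xy by (auto simp: car)
    then show ?thesis
      by (simp add: add_loc_module)
  qed
  show "\<zero>\<^bsub>?L\<^esub> \<in> carrier ?L"
    using e by (simp add: zero_loc_module[OF e])
  show "(x \<oplus>\<^bsub>?L\<^esub> y) \<oplus>\<^bsub>?L\<^esub> z = x \<oplus>\<^bsub>?L\<^esub> (y \<oplus>\<^bsub>?L\<^esub> z)"
    if "x \<in> carrier ?L" "y \<in> carrier ?L" "z \<in> carrier ?L" for x y z
    using that
    by (clarsimp simp: car add_loc_module smult_r_distr smult_assoc1[symmetric] m_ac M.a_ac)
  show "x \<oplus>\<^bsub>?L\<^esub> y = y \<oplus>\<^bsub>?L\<^esub> x" if "x \<in> carrier ?L" "y \<in> carrier ?L" for x y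
    using that by (clarsimp simp: car add_loc_module m_comm M.a_comm)
  show "\<zero>\<^bsub>?L\<^esub> \<oplus>\<^bsub>?L\<^esub> x = x" if "x \<in> carrier ?L" for x
    using that e
    by (clarsimp simp: car add_loc_module zero_loc_module[OF e])
      (rule fraction_eqI; simp add: smult_assoc1[symmetric] m_comm)
  show "\<exists>y\<in>carrier ?L. y \<oplus>\<^bsub>?L\<^esub> x = \<zero>\<^bsub>?L\<^esub>" if x: "x \<in> carrier ?L" for x
  proof -
    obtain m s where m: "m \<in> carrier M" "s \<in> S" "x = fraction M S m s" using x by (auto simp: car)
    have "fraction M S (\<ominus>\<^bsub>M\<^esub> m) s \<oplus>\<^bsub>?L\<^esub> x = \<zero>\<^bsub>?L\<^esub>"
      using m e
      by (clarsimp simp: add_loc_module zero_loc_module[OF e] smult_r_minus M.l_neg)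
        (rule fraction_eqI; simp)
    moreover have "fraction M S (\<ominus>\<^bsub>M\<^esub> m) s \<in> carrier ?L" using m by simp
    ultimately show ?thesis by blast
  qed
qed

end

sublocale module_loc \<subseteq> reg: module_loc R "regular_module R" S
  by (intro module_loc.intro R.regular_module module_loc_axioms.intro S)

context module_loc
begin

lemma regular_module_simps:
  "carrier (regular_module R) = carrier R" "smult (regular_module R) = mult R"
  "add (regular_module R) = add R" "zero (regular_module R) = \<zero>"
  by (simp_all add: regular_module_def)

lemma one_loc_ring: "s \<in> S \<Longrightarrow> \<one>\<^bsub>loc_ring R S\<^esub> = ring_fraction R S s s"
proof -
  assume s: "s \<in> S"
  have *: "ring_fraction R S t t = ring_fraction R S s s" if "t \<in> S" for t
    using that s by (intro reg.fraction_eqI) (auto simp: regular_module_simps m_comm)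
  have "(\<Union>t\<in>S. ring_fraction R S t t) = (\<Union>t\<in>S. ring_fraction R S s s)"
    by (intro SUP_cong refl *)
  then show ?thesis using S_nonempty by (simp add: loc_ring_def)
qed

lemma smult_loc_module:
  assumes "a \<in> carrier R" "s \<in> S" "m \<in> carrier M" "t \<in> S"
  shows "ring_fraction R S a s \<odot>\<^bsub>loc_module R M S\<^esub> fraction M S m t = fraction M S (a \<odot>\<^bsub>M\<^esub> m) (s \<otimes> t)"
proof -
  have *: "fraction M S (a' \<odot>\<^bsub>M\<^esub> m') (s' \<otimes> t') = fraction M S (a \<odot>\<^bsub>M\<^esub> m) (s \<otimes> t)"
    if a': "a' \<in> carrier R" "s' \<in> S" "ring_fraction R S a' s' = ring_fraction R S a s"
      and m': "m' \<in> carrier M" "t' \<in> S" "fraction M S m' t' = fraction M S m t" for a' s' m' t'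
  proof -
    obtain u where u: "u \<in> S" "(u \<otimes> s) \<otimes> a' = (u \<otimes> s') \<otimes> a"
      using a' assms by (auto simp: reg.fraction_eq_iff regular_module_simps)
    obtain v where v: "v \<in> S" "(v \<otimes> t) \<odot>\<^bsub>M\<^esub> m' = (v \<otimes> t') \<odot>\<^bsub>M\<^esub> m"
      using m' assms by (auto simp: fraction_eq_iff)
    note cl = assms a'(1,2) m'(1,2) u(1) v(1)
    have "((u \<otimes> v) \<otimes> (s \<otimes> t)) \<odot>\<^bsub>M\<^esub> (a' \<odot>\<^bsub>M\<^esub> m') = (((u \<otimes> s) \<otimes> a') \<otimes> (v \<otimes> t)) \<odot>\<^bsub>M\<^esub> m'"
      using cl by (simp add: smult_assoc1[symmetric] m_ac)
    also have "\<dots> = ((u \<otimes> s') \<otimes> a) \<odot>\<^bsub>M\<^esub> ((v \<otimes> t) \<odot>\<^bsub>M\<^esub> m')"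
      unfolding u(2) using cl by (intro smult_assoc1) auto
    also have "\<dots> = ((u \<otimes> v) \<otimes> (s' \<otimes> t')) \<odot>\<^bsub>M\<^esub> (a \<odot>\<^bsub>M\<^esub> m)"
      unfolding v(2) using cl by (simp add: smult_assoc1[symmetric] m_ac)
    finally show ?thesis
      using cl by (subst fraction_eq_iff) (auto intro!: bexI[of _ "u \<otimes> v"])
  qed
  show ?thesis
    using assms
    by (simp add: loc_module_def)
      (intro UN_fraction_eqI reg.UN_fraction_eqI *; simp add: regular_module_simps)
qed

lemma loc_ring_regular:
  "carrier (loc_ring R S) = carrier (loc_module R (regular_module R) S)"
  "add (loc_ring R S) = add (loc_module R (regular_module R) S)"
  "zero (loc_ring R S) = zero (loc_module R (regular_module R) S)"
  "mult (loc_ring R S) = smult (loc_module R (regular_module R) S)"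
  by (simp_all add: loc_ring_def loc_module_def regular_module_simps)

end

context module_loc
begin

lemmas mult_loc_ring = reg.smult_loc_module[folded loc_ring_regular, unfolded regular_module_simps]
lemmas add_loc_ring = reg.add_loc_module[folded loc_ring_regular, unfolded regular_module_simps]
lemmas zero_loc_ring = reg.zero_loc_module[folded loc_ring_regular, unfolded regular_module_simps]

lemma carrier_loc_ring:
  "carrier (loc_ring R S) = {ring_fraction R S a s | a s. a \<in> carrier R \<and> s \<in> S}"
  by (simp add: loc_ring_def)

lemma carrier_loc_module:
  "carrier (loc_module R M S) = {fraction M S m s | m s. m \<in> carrier M \<and> s \<in> S}"
  by (simp add: loc_module_def)

lemma ring_fraction_eqI:
  assumes "a \<in> carrier R" "s \<in> S" "b \<in> carrier R" "t \<in> S" "t \<otimes> a = s \<otimes> b"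
  shows "ring_fraction R S a s = ring_fraction R S b t"
  using assms by (intro reg.fraction_eqI) (auto simp: regular_module_simps)

lemma ring_fraction_in_carrier [simp, intro]:
  "a \<in> carrier R \<Longrightarrow> s \<in> S \<Longrightarrow> ring_fraction R S a s \<in> carrier (loc_ring R S)"
  by (auto simp: loc_ring_def)

lemma cring_loc_ring: "cring (loc_ring R S)" (is "cring ?L")
proof (rule cringI)
  obtain e where e: "e \<in> S" using S_nonempty by auto
  show "abelian_group ?L"
    by (rule abelian_group_transfer[OF reg.abelian_group_loc_module]) (rule loc_ring_regular)+
  show "comm_monoid ?L"
  proof (rule comm_monoidI)
    show "x \<otimes>\<^bsub>?L\<^esub> y \<in> carrier ?L" if xy: "x \<in> carrier ?L" "y \<in> carrier ?L" for x y
    proof -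
      obtain a s b t where "a \<in> carrier R" "s \<in> S" "x = ring_fraction R S a s"
        "b \<in> carrier R" "t \<in> S" "y = ring_fraction R S b t" using xy by (auto simp: carrier_loc_ring)
      then show ?thesis
        by (simp add: mult_loc_ring)
    qed
    show "\<one>\<^bsub>?L\<^esub> \<in> carrier ?L"
      using e by (simp add: one_loc_ring[OF e])
    show "(x \<otimes>\<^bsub>?L\<^esub> y) \<otimes>\<^bsub>?L\<^esub> z = x \<otimes>\<^bsub>?L\<^esub> (y \<otimes>\<^bsub>?L\<^esub> z)"
      if "x \<in> carrier ?L" "y \<in> carrier ?L" "z \<in> carrier ?L" for x y z
      using that by (clarsimp simp: carrier_loc_ring mult_loc_ring m_assoc)
    show "\<one>\<^bsub>?L\<^esub> \<otimes>\<^bsub>?L\<^esub> x = x" if "x \<in> carrier ?L" for x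
      using that e
      by (clarsimp simp: carrier_loc_ring mult_loc_ring one_loc_ring[OF e])
        (rule ring_fraction_eqI; simp add: m_ac)
    show "x \<otimes>\<^bsub>?L\<^esub> y = y \<otimes>\<^bsub>?L\<^esub> x" if "x \<in> carrier ?L" "y \<in> carrier ?L" for x y
      using that by (clarsimp simp: carrier_loc_ring mult_loc_ring m_comm)
  qed
  show "(x \<oplus>\<^bsub>?L\<^esub> y) \<otimes>\<^bsub>?L\<^esub> z = x \<otimes>\<^bsub>?L\<^esub> z \<oplus>\<^bsub>?L\<^esub> y \<otimes>\<^bsub>?L\<^esub> z"
    if "x \<in> carrier ?L" "y \<in> carrier ?L" "z \<in> carrier ?L" for x y z
    using that
    by (clarsimp simp: carrier_loc_ring mult_loc_ring add_loc_ring)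
      (rule ring_fraction_eqI; simp add: R.l_distr R.r_distr m_ac)
qed

lemma module_loc_module: "module (loc_ring R S) (loc_module R M S)" (is "module ?A ?L")
proof (rule moduleI)
  obtain e where e: "e \<in> S" using S_nonempty by auto
  show "cring ?A" by (rule cring_loc_ring)
  show "abelian_group ?L" by (rule abelian_group_loc_module)
  show "a \<odot>\<^bsub>?L\<^esub> x \<in> carrier ?L" if ax: "a \<in> carrier ?A" "x \<in> carrier ?L" for a x
  proof -
    obtain b s m t where "b \<in> carrier R" "s \<in> S" "a = ring_fraction R S b s"
      "m \<in> carrier M" "t \<in> S" "x = fraction M S m t"
      using ax by (auto simp: carrier_loc_ring carrier_loc_module)
    then show ?thesis
      by (simp add: smult_loc_module)
  qed
  show "(a \<oplus>\<^bsub>?A\<^esub> b) \<odot>\<^bsub>?L\<^esub> x = a \<odot>\<^bsub>?L\<^esub> x \<oplus>\<^bsub>?L\<^esub> b \<odot>\<^bsub>?L\<^esub> x"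
    if "a \<in> carrier ?A" "b \<in> carrier ?A" "x \<in> carrier ?L" for a b x
    using that
    by (clarsimp simp: carrier_loc_ring carrier_loc_module smult_loc_module add_loc_ring
          add_loc_module)
      (rule fraction_eqI; simp add: smult_l_distr smult_r_distr smult_assoc1[symmetric] m_ac)
  show "a \<odot>\<^bsub>?L\<^esub> (x \<oplus>\<^bsub>?L\<^esub> y) = a \<odot>\<^bsub>?L\<^esub> x \<oplus>\<^bsub>?L\<^esub> a \<odot>\<^bsub>?L\<^esub> y"
    if "a \<in> carrier ?A" "x \<in> carrier ?L" "y \<in> carrier ?L" for a x y
    using that
    by (clarsimp simp: carrier_loc_ring carrier_loc_module smult_loc_module add_loc_module)
      (rule fraction_eqI; simp add: smult_r_distr smult_assoc1[symmetric] m_ac)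
  show "(a \<otimes>\<^bsub>?A\<^esub> b) \<odot>\<^bsub>?L\<^esub> x = a \<odot>\<^bsub>?L\<^esub> (b \<odot>\<^bsub>?L\<^esub> x)"
    if "a \<in> carrier ?A" "b \<in> carrier ?A" "x \<in> carrier ?L" for a b x
    using that
    by (clarsimp simp: carrier_loc_ring carrier_loc_module smult_loc_module mult_loc_ring
        smult_assoc1 m_assoc)
  show "\<one>\<^bsub>?A\<^esub> \<odot>\<^bsub>?L\<^esub> x = x" if "x \<in> carrier ?L" for x
    using that e
    by (clarsimp simp: carrier_loc_module smult_loc_module one_loc_ring[OF e])
      (rule fraction_eqI; simp add: smult_assoc1[symmetric] m_ac)
qed

end

end

theory Submission
  imports Defs
begin

text \<open>
  Everything rests on two translations. A fraction \<open>m / r\<close> lies in \<open>S\<^sup>-\<^sup>1N\<close> iff \<open>u m \<in> N\<close> for some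
  \<open>u \<in> S\<close>, and \<open>m / r = 0\<close> iff \<open>u m = 0\<close> for some \<open>u \<in> S\<close>. So clearing denominators in
  \<open>0 \<noteq> (a/t)(m/r) \<in> S\<^sup>-\<^sup>1N\<close> yields \<open>0 \<noteq> a (u m) \<in> N\<close>, to which the weakly \<open>S\<close>-primary condition
  applies. Conversely, a uniform \<open>s\<close> with \<open>(N : t) \<subseteq> (N : s)\<close> for all \<open>t \<in> S\<close> replaces the
  varying \<open>u\<close>, so that \<open>(a/s)\<^sup>n \<in> (S\<^sup>-\<^sup>1N : S\<^sup>-\<^sup>1M)\<close> gives \<open>s a\<^sup>n M \<subseteq> N\<close>.
\<close>

section \<open>Residuals of a submodule\<close>

context module
begin

lemma submodule_zero: "submodule N R M \<Longrightarrow> \<zero>\<^bsub>M\<^esub> \<in> N"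
  using submodule.axioms(1)[THEN subgroup.one_closed] by fastforce

text \<open>The preimage of \<open>N\<close> under multiplication by \<open>a\<close>, a linear map
  because \<open>R\<close> is commutative. It lets a multiplier that works on generators work on all
  of \<open>M\<close>.\<close>

lemma submodule_elt_residual:
  assumes N: "submodule N R M" and a: "a \<in> carrier R"
  shows "submodule (elt_residual M N a) R M"
proof (rule submoduleI)
  fix r m assume "r \<in> carrier R" "m \<in> elt_residual M N a"
  then have "r \<in> carrier R" "m \<in> carrier M" "a \<odot>\<^bsub>M\<^esub> m \<in> N" by (auto simp: elt_residual_def)
  moreover have "a \<odot>\<^bsub>M\<^esub> (r \<odot>\<^bsub>M\<^esub> m) = r \<odot>\<^bsub>M\<^esub> (a \<odot>\<^bsub>M\<^esub> m)"
    using a calculation by (simp add: smult_assoc1[symmetric] m_comm)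
  ultimately show "r \<odot>\<^bsub>M\<^esub> m \<in> elt_residual M N a"
    using submoduleE(4)[OF N] by (simp add: elt_residual_def)
qed (use a submoduleE[OF N] submodule_zero[OF N] in \<open>auto simp: elt_residual_def smult_r_distr smult_r_minus\<close>)

lemma residual_mult:
  assumes "submodule N R M" "a \<in> carrier R" "r \<in> residual R M N"
  shows "a \<otimes> r \<in> residual R M N"
  using assms submoduleE(4)[OF assms(1)] by (auto simp: residual_def smult_assoc1)

lemma elt_residual_mono:
  assumes "submodule N R M" "a \<in> carrier R" "b \<in> carrier R"
  shows "elt_residual M N a \<subseteq> elt_residual M N (b \<otimes> a)"
  using assms submoduleE(4)[OF assms(1)] by (auto simp: elt_residual_def smult_assoc1)

end

section \<open>Fractions: powers, vanishing, membership in \<open>S\<^sup>-\<^sup>1N\<close>\<close>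

context module_loc
begin

lemma carrier_loc_ringE:
  assumes "x \<in> carrier (loc_ring R S)"
  obtains a s where "a \<in> carrier R" "s \<in> S" "x = ring_fraction R S a s"
  using assms by (simp only: carrier_loc_ring mem_Collect_eq) metis

lemma carrier_loc_moduleE:
  assumes "x \<in> carrier (loc_module R M S)"
  obtains m s where "m \<in> carrier M" "s \<in> S" "x = fraction M S m s"
  using assms by (simp only: carrier_loc_module mem_Collect_eq) metis

lemma loc_submoduleE:
  assumes "x \<in> loc_submodule M S N"
  obtains n s where "n \<in> N" "s \<in> S" "x = fraction M S n s"
  using assms by (simp only: loc_submodule_def mem_Collect_eq) metis

lemma loc_submoduleI [intro]:
  "n \<in> N \<Longrightarrow> s \<in> S \<Longrightarrow> fraction M S n s \<in> loc_submodule M S N"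
  by (auto simp only: loc_submodule_def)

text \<open>Exponent 0 is excluded because \<open>\<one>\<close> need not lie in \<open>S\<close>;
  this matches the positive exponents in \<open>radical\<close>.\<close>

lemma pow_closed: "s \<in> S \<Longrightarrow> n > 0 \<Longrightarrow> s [^] (n::nat) \<in> S"
proof (induction n)
  case (Suc n)
  then show ?case by (cases "n = 0") auto
qed simp

lemma ring_fraction_pow:
  assumes "a \<in> carrier R" "s \<in> S" "n > 0"
  shows "ring_fraction R S a s [^]\<^bsub>loc_ring R S\<^esub> (n::nat) = ring_fraction R S (a [^] n) (s [^] n)"
  using assms(3)
proof (induction n rule: nat_induct_non_zero)
  case 1
  interpret L: cring "loc_ring R S" by (rule cring_loc_ring)
  show ?case using assms(1,2) by simp
next
  case (Suc n)
  then show ?case using assms(1,2) by (simp add: mult_loc_ring pow_closed)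
qed

lemma fraction_cancel:
  assumes "m \<in> carrier M" "r \<in> S" "u \<in> S"
  shows "fraction M S (u \<odot>\<^bsub>M\<^esub> m) (u \<otimes> r) = fraction M S m r"
  using assms by (intro fraction_eqI) (auto simp: smult_assoc1[symmetric] m_comm)

text \<open>Writing zero as 0/r with the same denominator turns equality into (u r) m = 0, and u r
  is itself in \<open>S\<close>. Conversely, u m = 0 can be multiplied by r.\<close>

lemma fraction_eq_zero_iff:
  assumes "m \<in> carrier M" "r \<in> S"
  shows "fraction M S m r = \<zero>\<^bsub>loc_module R M S\<^esub> \<longleftrightarrow> (\<exists>u\<in>S. u \<odot>\<^bsub>M\<^esub> m = \<zero>\<^bsub>M\<^esub>)"
proof -
  have "fraction M S m r = \<zero>\<^bsub>loc_module R M S\<^esub> \<longleftrightarrow> (\<exists>u\<in>S. (u \<otimes> r) \<odot>\<^bsub>M\<^esub> m = \<zero>\<^bsub>M\<^esub>)"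
    using assms by (auto simp: zero_loc_module[OF assms(2)] fraction_eq_iff)
  also have "\<dots> \<longleftrightarrow> (\<exists>u\<in>S. u \<odot>\<^bsub>M\<^esub> m = \<zero>\<^bsub>M\<^esub>)"
  proof
    assume "\<exists>u\<in>S. u \<odot>\<^bsub>M\<^esub> m = \<zero>\<^bsub>M\<^esub>"
    then obtain u where "u \<in> S" "u \<odot>\<^bsub>M\<^esub> m = \<zero>\<^bsub>M\<^esub>" by blast
    then have "(u \<otimes> r) \<odot>\<^bsub>M\<^esub> m = \<zero>\<^bsub>M\<^esub>" using assms by (simp add: m_comm[of u r] smult_assoc1)
    then show "\<exists>u\<in>S. (u \<otimes> r) \<odot>\<^bsub>M\<^esub> m = \<zero>\<^bsub>M\<^esub>" using \<open>u \<in> S\<close> by blast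
  qed (use assms in blast)
  finally show ?thesis .
qed

text \<open>If m/r = n/q with n in \<open>N\<close>, then (u q) m = (u r) n lies in
  \<open>N\<close>, so u q is the required multiplier. Conversely, m/r expands to (u m)/(u
  r).\<close>

lemma fraction_in_loc_submodule_iff:
  assumes N: "submodule N R M" and m: "m \<in> carrier M" and r: "r \<in> S"
  shows "fraction M S m r \<in> loc_submodule M S N \<longleftrightarrow> (\<exists>u\<in>S. u \<odot>\<^bsub>M\<^esub> m \<in> N)"
proof
  assume "fraction M S m r \<in> loc_submodule M S N"
  then obtain n q where nq: "n \<in> N" "q \<in> S" "fraction M S m r = fraction M S n q"
    by (rule loc_submoduleE)
  moreover have "n \<in> carrier M" using nq submoduleE(1)[OF N] by blast
  ultimately obtain u where u: "u \<in> S" "(u \<otimes> q) \<odot>\<^bsub>M\<^esub> m = (u \<otimes> r) \<odot>\<^bsub>M\<^esub> n"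
    using m r by (auto simp: fraction_eq_iff)
  then have "(u \<otimes> q) \<odot>\<^bsub>M\<^esub> m \<in> N" using submoduleE(4)[OF N] r nq by simp
  then show "\<exists>u\<in>S. u \<odot>\<^bsub>M\<^esub> m \<in> N" using u nq by blast
next
  assume "\<exists>u\<in>S. u \<odot>\<^bsub>M\<^esub> m \<in> N"
  then obtain u where u: "u \<in> S" "u \<odot>\<^bsub>M\<^esub> m \<in> N" by blast
  then show "fraction M S m r \<in> loc_submodule M S N"
    unfolding fraction_cancel[OF m r u(1), symmetric] using r by (intro loc_submoduleI S_closed)
qed

section \<open>The submodule \<open>S\<^sup>-\<^sup>1N\<close> and when it is all of
  \<open>S\<^sup>-\<^sup>1M\<close>\<close>

lemma submodule_loc_submodule:
  assumes N: "submodule N R M"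
  shows "submodule (loc_submodule M S N) (loc_ring R S) (loc_module R M S)"
proof -
  interpret L: module "loc_ring R S" "loc_module R M S" by (rule module_loc_module)
  have car: "n \<in> carrier M" if "n \<in> N" for n using that submoduleE(1)[OF N] by blast
  obtain e where e: "e \<in> S" using S_nonempty by auto
  show ?thesis
  proof (rule L.submoduleI)
    show "loc_submodule M S N \<subseteq> carrier (loc_module R M S)"
      using car by (auto elim!: loc_submoduleE simp only: intro!: fraction_in_carrier)
    show "\<zero>\<^bsub>loc_module R M S\<^esub> \<in> loc_submodule M S N"
      unfolding zero_loc_module[OF e] using submodule_zero[OF N] e by (rule loc_submoduleI)
    show smult: "a \<odot>\<^bsub>loc_module R M S\<^esub> x \<in> loc_submodule M S N"
      if a: "a \<in> carrier (loc_ring R S)" and x: "x \<in> loc_submodule M S N" for a x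
    proof -
      obtain b t n r where *: "b \<in> carrier R" "t \<in> S" "a = ring_fraction R S b t"
        "n \<in> N" "r \<in> S" "x = fraction M S n r"
        using a x by (elim carrier_loc_ringE loc_submoduleE)
      have "a \<odot>\<^bsub>loc_module R M S\<^esub> x = fraction M S (b \<odot>\<^bsub>M\<^esub> n) (t \<otimes> r)"
        using * car by (simp add: smult_loc_module)
      then show ?thesis
        using * submoduleE(4)[OF N] by (simp add: loc_submoduleI)
    qed
    show "\<ominus>\<^bsub>loc_module R M S\<^esub> x \<in> loc_submodule M S N" if "x \<in> loc_submodule M S N" for x
    proof -
      have x: "x \<in> carrier (loc_module R M S)"
        using that car by (elim loc_submoduleE) simp
      \<comment> \<open>Negation is scalar multiplication by -1, so it reduces to closure under
        scalars.\<close>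
      have "\<ominus>\<^bsub>loc_module R M S\<^esub> x = (\<ominus>\<^bsub>loc_ring R S\<^esub> \<one>\<^bsub>loc_ring R S\<^esub>) \<odot>\<^bsub>loc_module R M S\<^esub> x"
        using x by (simp add: L.smult_l_minus)
      then show ?thesis using smult[OF _ that] by simp
    qed
    show "x \<oplus>\<^bsub>loc_module R M S\<^esub> y \<in> loc_submodule M S N"
      if x: "x \<in> loc_submodule M S N" and y: "y \<in> loc_submodule M S N" for x y
    proof -
      obtain m s n t where *: "m \<in> N" "s \<in> S" "x = fraction M S m s"
        "n \<in> N" "t \<in> S" "y = fraction M S n t" using x y by (elim loc_submoduleE)
      have "x \<oplus>\<^bsub>loc_module R M S\<^esub> y = fraction M S (t \<odot>\<^bsub>M\<^esub> m \<oplus>\<^bsub>M\<^esub> s \<odot>\<^bsub>M\<^esub> n) (s \<otimes> t)"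
        using * car by (simp add: add_loc_module)
      then show ?thesis
        using * submoduleE(4,5)[OF N] by (simp add: loc_submoduleI)
    qed
  qed
qed

text \<open>The membership criterion does not mention the denominator, so the quantifier over
  denominators disappears once \<open>S\<close> is known to be non-empty.\<close>

lemma loc_submodule_eq_carrier_iff:
  assumes N: "submodule N R M"
  shows "loc_submodule M S N = carrier (loc_module R M S) \<longleftrightarrow>
    (\<forall>m\<in>carrier M. \<exists>u\<in>S. u \<odot>\<^bsub>M\<^esub> m \<in> N)"
proof -
  interpret L: module "loc_ring R S" "loc_module R M S" by (rule module_loc_module)
  have "loc_submodule M S N = carrier (loc_module R M S) \<longleftrightarrow>
      (\<forall>x\<in>carrier (loc_module R M S). x \<in> loc_submodule M S N)"
    using L.submoduleE(1)[OF submodule_loc_submodule[OF N]] by blast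
  also have "\<dots> \<longleftrightarrow> (\<forall>m\<in>carrier M. \<forall>r\<in>S. fraction M S m r \<in> loc_submodule M S N)"
    by (metis fraction_in_carrier carrier_loc_moduleE)
  also have "\<dots> \<longleftrightarrow> (\<forall>m\<in>carrier M. \<exists>u\<in>S. u \<odot>\<^bsub>M\<^esub> m \<in> N)"
    using S_nonempty by (simp add: fraction_in_loc_submodule_iff[OF N] ex_in_conv[symmetric])
  finally show ?thesis .
qed

text \<open>Each generator has its own multiplier into \<open>N\<close>; the product of these
  finitely many multipliers serves all generators at once, hence all of \<open>M\<close>.\<close>

lemma residual_meets_if_finitely_generated:
  assumes N: "submodule N R M" and fg: "finitely_generated R M"
    and tors: "\<And>m. m \<in> carrier M \<Longrightarrow> \<exists>u\<in>S. u \<odot>\<^bsub>M\<^esub> m \<in> N"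
  shows "residual R M N \<inter> S \<noteq> {}"
proof -
  obtain G where G: "finite G" "G \<subseteq> carrier M"
    and gen: "\<Inter>{H. submodule H R M \<and> G \<subseteq> H} = carrier M"
    using fg by (auto simp: finitely_generated_def)
  have "\<exists>u\<in>S. G \<subseteq> elt_residual M N u"
    using G
  proof (induction G rule: finite_induct)
    \<comment> \<open>The empty product may be missing from \<open>S\<close>, but with no generators
      any element of \<open>S\<close> works.\<close>
    case empty
    then show ?case using S_nonempty by auto
  next
    case (insert g G)
    then obtain u where u: "u \<in> S" "G \<subseteq> elt_residual M N u" by auto
    obtain v where v: "v \<in> S" "v \<odot>\<^bsub>M\<^esub> g \<in> N" using tors[of g] insert by auto
    have "g \<in> elt_residual M N v" using v insert by (simp add: elt_residual_def)
    \<comment> \<open>By commutativity, u v is a multiple of both u and v, so it handles the old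
      generators and the new one.\<close>
    then have "insert g G \<subseteq> elt_residual M N (u \<otimes> v)"
      using u v elt_residual_mono[OF N, of v u] elt_residual_mono[OF N, of u v] m_comm[of u v] by auto
    then show ?case using u v by blast
  qed
  then obtain u where u: "u \<in> S" "G \<subseteq> elt_residual M N u" by blast
  \<comment> \<open>The residual of u is one of the submodules containing \<open>G\<close> whose
    intersection is \<open>M\<close>.\<close>
  then have "carrier M \<subseteq> elt_residual M N u"
    using submodule_elt_residual[OF N, of u] unfolding gen[symmetric] by blast
  then show ?thesis using u by (auto simp: residual_def elt_residual_def)
qed

section \<open>From weakly \<open>S\<close>-primary to weakly primary\<close>

text \<open>The fixed s of the weakly \<open>S\<close>-primary condition is the uniform multiplier.
  For m nonzero and t m in \<open>N\<close>, t m is nonzero because t is no zero divisor on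
  \<open>M\<close>, so the condition applies with a = t.\<close>

lemma weakly_S_primary_imp_elt_residual_max:
  assumes "weakly_S_primary R M S N" and Z: "zero_divisors_on R M \<inter> S = {}"
  shows "\<exists>s\<in>S. \<forall>t\<in>S. elt_residual M N t \<subseteq> elt_residual M N s"
proof -
  obtain s where N: "submodule N R M" and disj: "residual R M N \<inter> S = {}" and s: "s \<in> S"
    and prim: "\<And>a m. a \<in> carrier R \<Longrightarrow> m \<in> carrier M \<Longrightarrow> a \<odot>\<^bsub>M\<^esub> m \<noteq> \<zero>\<^bsub>M\<^esub> \<Longrightarrow> a \<odot>\<^bsub>M\<^esub> m \<in> N \<Longrightarrow>
      s \<otimes> a \<in> radical R (residual R M N) \<or> s \<odot>\<^bsub>M\<^esub> m \<in> N"
    using assms(1) unfolding weakly_S_primary_def by blast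
  have "s \<odot>\<^bsub>M\<^esub> m \<in> N" if t: "t \<in> S" and m: "m \<in> carrier M" "t \<odot>\<^bsub>M\<^esub> m \<in> N" for t m
  proof (cases "m = \<zero>\<^bsub>M\<^esub>")
    case True
    then show ?thesis using s submodule_zero[OF N] by simp
  next
    case False
    then have "t \<odot>\<^bsub>M\<^esub> m \<noteq> \<zero>\<^bsub>M\<^esub>" using Z t m by (auto simp: zero_divisors_on_def)
    \<comment> \<open>Positive powers of s t stay in \<open>S\<close>, which is disjoint from the
      residual; only the alternative s m in \<open>N\<close> remains.\<close>
    moreover have "s \<otimes> t \<notin> radical R (residual R M N)"
      using disj s t pow_closed[of "s \<otimes> t"] by (auto simp: radical_def)
    ultimately show ?thesis using prim[of t m] t m by blast
  qed
  then show ?thesis using s by (auto simp: elt_residual_def intro!: bexI[of _ s])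
qed

text \<open>If \<open>S\<^sup>-\<^sup>1N\<close> were everything, every m would have a multiplier
  into \<open>N\<close>. Finite generation, or else the uniform s, makes one multiplier work for all
  m, so the residual would meet \<open>S\<close>.\<close>

lemma loc_submodule_proper:
  assumes "weakly_S_primary R M S N"
    and "finitely_generated R M \<or> zero_divisors_on R M \<inter> S = {}"
  shows "loc_submodule M S N \<noteq> carrier (loc_module R M S)"
proof
  assume eq: "loc_submodule M S N = carrier (loc_module R M S)"
  have N: "submodule N R M" and disj: "residual R M N \<inter> S = {}"
    using assms(1) unfolding weakly_S_primary_def by blast+
  have tors: "\<exists>u\<in>S. u \<odot>\<^bsub>M\<^esub> m \<in> N" if "m \<in> carrier M" for m
    using eq that loc_submodule_eq_carrier_iff[OF N] by blast
  from assms(2) show False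
  proof
    assume "finitely_generated R M"
    then show False using residual_meets_if_finitely_generated[OF N _ tors] disj by blast
  next
    assume "zero_divisors_on R M \<inter> S = {}"
    then obtain s where "s \<in> S" "\<forall>t\<in>S. elt_residual M N t \<subseteq> elt_residual M N s"
      using weakly_S_primary_imp_elt_residual_max[OF assms(1)] by blast
    moreover have "m \<in> elt_residual M N s" if m: "m \<in> carrier M" for m
    proof -
      obtain t where "t \<in> S" "m \<in> elt_residual M N t"
        using tors[OF m] m by (auto simp: elt_residual_def)
      then show ?thesis using calculation by blast
    qed
    ultimately have "s \<in> residual R M N" by (auto simp: residual_def elt_residual_def)
    then show False using disj \<open>s \<in> S\<close> by blast
  qed
qed

lemma weakly_primary_loc_submodule:
  assumes "weakly_S_primary R M S N"
    and proper: "loc_submodule M S N \<noteq> carrier (loc_module R M S)"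
  shows "weakly_primary (loc_ring R S) (loc_module R M S) (loc_submodule M S N)"
  unfolding weakly_primary_def
proof (intro conjI ballI impI)
  let ?A = "loc_ring R S" and ?X = "loc_module R M S" and ?P = "loc_submodule M S N"
  obtain s where N: "submodule N R M" and s: "s \<in> S"
    and prim: "\<And>a m. a \<in> carrier R \<Longrightarrow> m \<in> carrier M \<Longrightarrow> a \<odot>\<^bsub>M\<^esub> m \<noteq> \<zero>\<^bsub>M\<^esub> \<Longrightarrow> a \<odot>\<^bsub>M\<^esub> m \<in> N \<Longrightarrow>
      s \<otimes> a \<in> radical R (residual R M N) \<or> s \<odot>\<^bsub>M\<^esub> m \<in> N"
    using assms(1) unfolding weakly_S_primary_def by blast
  show "submodule ?P ?A ?X" by (rule submodule_loc_submodule[OF N])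
  show "?P \<noteq> carrier ?X" by (rule proper)
  fix \<alpha> x
  assume "\<alpha> \<in> carrier ?A" "x \<in> carrier ?X"
    and nz: "\<alpha> \<odot>\<^bsub>?X\<^esub> x \<noteq> \<zero>\<^bsub>?X\<^esub> \<and> \<alpha> \<odot>\<^bsub>?X\<^esub> x \<in> ?P"
  then obtain a t m r where a: "a \<in> carrier R" "t \<in> S" "\<alpha> = ring_fraction R S a t"
    and m: "m \<in> carrier M" "r \<in> S" "x = fraction M S m r"
    by (elim conjE carrier_loc_ringE carrier_loc_moduleE)
  have prod: "\<alpha> \<odot>\<^bsub>?X\<^esub> x = fraction M S (a \<odot>\<^bsub>M\<^esub> m) (t \<otimes> r)"
    using a m by (simp add: smult_loc_module)
  then obtain u where u: "u \<in> S" "u \<odot>\<^bsub>M\<^esub> (a \<odot>\<^bsub>M\<^esub> m) \<in> N"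
    using nz a m fraction_in_loc_submodule_iff[OF N, of "a \<odot>\<^bsub>M\<^esub> m" "t \<otimes> r"] by auto
  \<comment> \<open>Otherwise u would witness that the product of the two fractions is zero.\<close>
  have "u \<odot>\<^bsub>M\<^esub> (a \<odot>\<^bsub>M\<^esub> m) \<noteq> \<zero>\<^bsub>M\<^esub>"
    using nz a m u(1) prod fraction_eq_zero_iff[of "a \<odot>\<^bsub>M\<^esub> m" "t \<otimes> r"] by auto
  moreover have "u \<odot>\<^bsub>M\<^esub> (a \<odot>\<^bsub>M\<^esub> m) = a \<odot>\<^bsub>M\<^esub> (u \<odot>\<^bsub>M\<^esub> m)"
    using a m u by (simp add: smult_assoc1[symmetric] m_comm)
  ultimately have "s \<otimes> a \<in> radical R (residual R M N) \<or> s \<odot>\<^bsub>M\<^esub> (u \<odot>\<^bsub>M\<^esub> m) \<in> N"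
    using prim[of a "u \<odot>\<^bsub>M\<^esub> m"] a m u by auto
  then show "\<alpha> \<in> radical ?A (residual ?A ?X ?P) \<or> x \<in> ?P"
  proof
    assume "s \<otimes> a \<in> radical R (residual R M N)"
    then obtain n :: nat where n: "n > 0" "(s \<otimes> a) [^] n \<in> residual R M N"
      by (auto simp: radical_def)
    \<comment> \<open>Expanding a/t by s puts s a, the element with a power in the residual, into
      the numerator.\<close>
    have "\<alpha> = ring_fraction R S (s \<otimes> a) (s \<otimes> t)"
      unfolding a(3) using a(1,2) s by (intro ring_fraction_eqI) (auto simp: m_ac)
    then have pow: "\<alpha> [^]\<^bsub>?A\<^esub> n = ring_fraction R S ((s \<otimes> a) [^] n) ((s \<otimes> t) [^] n)"
      using a s n by (simp add: ring_fraction_pow)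
    have "\<alpha> [^]\<^bsub>?A\<^esub> n \<odot>\<^bsub>?X\<^esub> y \<in> ?P" if y: "y \<in> carrier ?X" for y
    proof -
      obtain k q where k: "k \<in> carrier M" "q \<in> S" "y = fraction M S k q"
        using y by (elim carrier_loc_moduleE)
      have "(s \<otimes> a) [^] n \<odot>\<^bsub>M\<^esub> k \<in> N" using n k by (auto simp: residual_def)
      moreover have "\<alpha> [^]\<^bsub>?A\<^esub> n \<odot>\<^bsub>?X\<^esub> y
          = fraction M S ((s \<otimes> a) [^] n \<odot>\<^bsub>M\<^esub> k) ((s \<otimes> t) [^] n \<otimes> q)"
        unfolding pow k(3) using k(1,2) a(1,2) s n by (simp add: smult_loc_module pow_closed)
      moreover have "(s \<otimes> t) [^] n \<otimes> q \<in> S" using a s n k by (simp add: pow_closed)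
      ultimately show ?thesis by (simp add: loc_submoduleI)
    qed
    moreover have "\<alpha> [^]\<^bsub>?A\<^esub> n \<in> carrier ?A" unfolding pow using a(1,2) s n by (simp add: pow_closed)
    ultimately show ?thesis
      using n \<open>\<alpha> \<in> carrier ?A\<close> by (auto simp: radical_def residual_def)
  next
    assume "s \<odot>\<^bsub>M\<^esub> (u \<odot>\<^bsub>M\<^esub> m) \<in> N"
    then have "(s \<otimes> u) \<odot>\<^bsub>M\<^esub> m \<in> N" using s u m by (simp add: smult_assoc1)
    then show ?thesis using fraction_in_loc_submodule_iff[OF N m(1,2)] s u m(3) by blast
  qed
qed

section \<open>From weakly primary back to weakly \<open>S\<close>-primary\<close>

text \<open>The uniform s becomes the fixed element required by \<open>weakly_S_primary\<close>: the
  primary condition is applied to a/s and m/s, and each resulting membership in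
  \<open>S\<^sup>-\<^sup>1N\<close> is brought back to \<open>N\<close> by s.\<close>

lemma weakly_S_primary_if_loc_submodule:
  assumes N: "submodule N R M" and Z: "zero_divisors_on R M \<inter> S = {}"
    and prim: "weakly_primary (loc_ring R S) (loc_module R M S) (loc_submodule M S N)"
    and s: "s \<in> S" and unif: "\<And>t. t \<in> S \<Longrightarrow> elt_residual M N t \<subseteq> elt_residual M N s"
  shows "weakly_S_primary R M S N"
proof -
  let ?A = "loc_ring R S" and ?X = "loc_module R M S" and ?P = "loc_submodule M S N"
  have unif': "s \<odot>\<^bsub>M\<^esub> m \<in> N" if "m \<in> carrier M" "r \<in> S" "fraction M S m r \<in> ?P" for m r
    using that unif fraction_in_loc_submodule_iff[OF N that(1,2)] by (auto simp: elt_residual_def)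
  \<comment> \<open>An element of \<open>S\<close> in the residual would multiply all of
    \<open>M\<close> into \<open>N\<close> and make \<open>S\<^sup>-\<^sup>1N\<close> everything,
    against properness.\<close>
  have "residual R M N \<inter> S = {}"
    using prim loc_submodule_eq_carrier_iff[OF N] by (auto simp: weakly_primary_def residual_def)
  moreover have "s \<otimes> a \<in> radical R (residual R M N) \<or> s \<odot>\<^bsub>M\<^esub> m \<in> N"
    if a: "a \<in> carrier R" and m: "m \<in> carrier M"
      and nz: "a \<odot>\<^bsub>M\<^esub> m \<noteq> \<zero>\<^bsub>M\<^esub>" and am: "a \<odot>\<^bsub>M\<^esub> m \<in> N" for a m
  proof -
    let ?\<alpha> = "ring_fraction R S a s" and ?x = "fraction M S m s"
    have prod: "?\<alpha> \<odot>\<^bsub>?X\<^esub> ?x = fraction M S (a \<odot>\<^bsub>M\<^esub> m) (s \<otimes> s)"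
      using a m s by (simp add: smult_loc_module)
    \<comment> \<open>If the product vanished, some u in \<open>S\<close> would kill the nonzero
      element a m and so be a zero divisor on \<open>M\<close>.\<close>
    have "?\<alpha> \<odot>\<^bsub>?X\<^esub> ?x \<noteq> \<zero>\<^bsub>?X\<^esub>"
      using Z a m s nz by (auto simp: prod fraction_eq_zero_iff zero_divisors_on_def)
    moreover have "?\<alpha> \<odot>\<^bsub>?X\<^esub> ?x \<in> ?P"
      unfolding prod using am s by (intro loc_submoduleI S_closed)
    ultimately consider "?\<alpha> \<in> radical ?A (residual ?A ?X ?P)" | "?x \<in> ?P"
      using prim a m s unfolding weakly_primary_def by blast
    then show ?thesis
    proof cases
      case 1
      then obtain n :: nat where n: "n > 0" "?\<alpha> [^]\<^bsub>?A\<^esub> n \<in> residual ?A ?X ?P"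
        by (auto simp: radical_def)
      have *: "(s \<otimes> a [^] n) \<odot>\<^bsub>M\<^esub> k \<in> N" if k: "k \<in> carrier M" for k
      proof -
        have "?\<alpha> [^]\<^bsub>?A\<^esub> n \<odot>\<^bsub>?X\<^esub> fraction M S k s \<in> ?P"
          using n k s by (auto simp: residual_def)
        then have "fraction M S (a [^] n \<odot>\<^bsub>M\<^esub> k) (s [^] n \<otimes> s) \<in> ?P"
          using n k s a by (simp add: ring_fraction_pow smult_loc_module pow_closed)
        then show ?thesis
          using unif'[of "a [^] n \<odot>\<^bsub>M\<^esub> k" "s [^] n \<otimes> s"] n k s a by (simp add: pow_closed smult_assoc1)
      qed
      \<comment> \<open>Only one factor s is needed to reach the residual; since n is positive, it
        can be split off from the n factors in (s a)^n, leaving s^(n-1) as a harmless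
        multiplier.\<close>
      obtain l where l: "n = Suc l" using n by (cases n) auto
      have "(s \<otimes> a) [^] n = s [^] l \<otimes> (s \<otimes> a [^] n)"
        using a s unfolding l nat_pow_distrib[OF S_carrier[OF s] a] by (simp add: m_ac)
      moreover have "s \<otimes> a [^] n \<in> residual R M N"
        using * a s by (auto simp: residual_def)
      ultimately have "(s \<otimes> a) [^] n \<in> residual R M N"
        using residual_mult[OF N] s by simp
      then show ?thesis using n a s by (auto simp: radical_def)
    next
      case 2
      then show ?thesis using unif'[OF m s] by blast
    qed
  qed
  ultimately show ?thesis using N s unfolding weakly_S_primary_def by blast
qed

end

text \<open>Weakly primary includes proper, and \<open>S\<^sup>-\<^sup>1N\<close> may fail to be
  proper, so the first implication carries a disjunction: properness itself, or either of two
  conditions that force it.\<close>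

theorem proposition3:
  fixes R :: "('a, 'x) ring_scheme" and M :: "('a, 'b, 'y) module_scheme"
    and N :: "'b set" and S :: "'a set"
  assumes "module R M" and "submodule N R M" and "mult_closed R S"
  shows
    "(weakly_S_primary R M S N \<longrightarrow>
        (loc_submodule M S N \<noteq> carrier (loc_module R M S)
            \<or> finitely_generated R M \<or> zero_divisors_on R M \<inter> S = {} \<longrightarrow>
          weakly_primary (loc_ring R S) (loc_module R M S) (loc_submodule M S N)) \<and>
        (zero_divisors_on R M \<inter> S = {} \<longrightarrow>
          (\<exists>s\<in>S. \<forall>t\<in>S. elt_residual M N t \<subseteq> elt_residual M N s))) \<and>
     (finitely_generated R M \<and> zero_divisors_on R M \<inter> S = {} \<and>
        weakly_primary (loc_ring R S) (loc_module R M S) (loc_submodule M S N) \<and>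
        (\<exists>s\<in>S. \<forall>t\<in>S. elt_residual M N t \<subseteq> elt_residual M N s) \<longrightarrow>
      weakly_S_primary R M S N)"
proof -
  interpret module_loc R M S
    using assms(1,3) by (intro module_loc.intro module_loc_axioms.intro)
  show ?thesis
  proof (intro conjI impI)
    assume prim: "weakly_S_primary R M S N"
      and "loc_submodule M S N \<noteq> carrier (loc_module R M S) \<or>
        finitely_generated R M \<or> zero_divisors_on R M \<inter> S = {}"
    then have "loc_submodule M S N \<noteq> carrier (loc_module R M S)"
      using loc_submodule_proper[OF prim] by argo
    with prim show "weakly_primary (loc_ring R S) (loc_module R M S) (loc_submodule M S N)"
      by (rule weakly_primary_loc_submodule)
  next
    assume "weakly_S_primary R M S N" "zero_divisors_on R M \<inter> S = {}"
    then show "\<exists>s\<in>S. \<forall>t\<in>S. elt_residual M N t \<subseteq> elt_residual M N s"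
      by (rule weakly_S_primary_imp_elt_residual_max)
  next
    assume *: "finitely_generated R M \<and> zero_divisors_on R M \<inter> S = {} \<and>
      weakly_primary (loc_ring R S) (loc_module R M S) (loc_submodule M S N) \<and>
      (\<exists>s\<in>S. \<forall>t\<in>S. elt_residual M N t \<subseteq> elt_residual M N s)"
    then obtain s where "s \<in> S" "\<forall>t\<in>S. elt_residual M N t \<subseteq> elt_residual M N s" by auto
    with * show "weakly_S_primary R M S N"
      by (intro weakly_S_primary_if_loc_submodule[OF assms(2), of s]) simp_all
  qed
qed

end
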